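(* Let $d\ge 2$ and let $p_0,\dots,p_d\ge 0$ be constants with $\sum_{i=0}^d p_i=1$. Let $(Z_n)_{n\ge0}$ be the Diaconis and Freedman's chain on $\Delta_d$ with constant weights $p_i(\mathbf{x})=p_i$ for all $\mathbf{x}\in\Delta_d$, $i=0,\dots,d$, and let $P$ be its transition operator. Let $\alpha\in(0,1]$. Then there is a unique $P$-invariant Borel probability measure $\nu$ on $\Delta_d$. Furthermore, there exist constants $\kappa>0$ and $\rho\in(0,1)$ such that $$\forall \varphi\in\mathcal H_\alpha(\Delta_d),\ \forall \mathbf{x}\in\Delta_d,\ \forall n\ge 0:\qquad |P^n\varphi(\mathbf{x})-\nu(\varphi)|\le \kappa\,\rho^n\,\|\varphi\|_\alpha .$$
   Context: $\Delta_d=\{\mathbf{x}\in\mathbb{R}^d: x_i\ge0,\ x_1+\dots+x_d\le 1\}$ is the closed simplex with vertices $\mathbf{e}_0=(0,\dots,0)$ and $\mathbf{e}_i$ the $i$-th standard basis vector, $1\le i\le d$. Given nonnegative continuous weight functions $p_0,\dots,p_d$ on $\Delta_d$ with $\sum_{i=0}^d p_i(\mathbf{x})=1$, the Diaconis and Freedman's chain $(Z_n)_{n\ge0}$ is the Markov chain on $\Delta_d$ which, when at $\mathbf{x}$, chooses the vertex $\mathbf{e}_i$ with probability $p_i(\mathbf{x})$ and then moves to $t\mathbf{x}+(1-t)\mathbf{e}_i$ with $t$ uniform on $(0,1)$. Its transition operator is $$Pf(\mathbf{x})=\sum_{i=0}^d p_i(\mathbf{x})\int_0^1 f(t\mathbf{x}+(1-t)\mathbf{e}_i)\,dt$$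 for bounded measurable $f:\Delta_d\to\mathbb{C}$. A Borel probability measure $\nu$ is $P$-invariant if $\nu(Pf)=\nu(f)$ for all bounded measurable $f$, where $\nu(f)=\int f\,d\nu$. For $0<\alpha\le1$, $\mathcal H_\alpha(\Delta_d)$ is the space of $\alpha$-Hölder continuous functions $f:\Delta_d\to\mathbb{C}$, with norm $\|f\|_\alpha=\|f\|_\infty+m_\alpha(f)$, $m_\alpha(f)=\sup_{\mathbf{x}\ne\mathbf{y}}\frac{|f(\mathbf{x})-f(\mathbf{y})|}{|\mathbf{x}-\mathbf{y}|^\alpha}$. *)

theory Defs
  imports "HOL-Probability.Probability"
begin

text \<open>The dimension d is CARD('d). Functions on the simplex are represented by total
  functions on the ambient space; only their values on the simplex matter below.\<close>

definition simplex_set :: "(real ^ 'd) set" where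
  "simplex_set = {x. (\<forall>i. 0 \<le> x $ i) \<and> (\<Sum>i\<in>UNIV. x $ i) \<le> 1}"

text \<open>The d + 1 indices 0, ..., d are the elements of the type \<^typ>\<open>'d option\<close>, where
  \<^term>\<open>None\<close> plays the role of the index 0.\<close>

fun simplex_vertex :: "'d option \<Rightarrow> real ^ 'd" where
  "simplex_vertex None = 0"
| "simplex_vertex (Some i) = axis i 1"

definition df_operator ::
  "('d::finite option \<Rightarrow> real ^ 'd \<Rightarrow> real) \<Rightarrow> (real ^ 'd \<Rightarrow> complex) \<Rightarrow> real ^ 'd \<Rightarrow> complex" where
  "df_operator p f x =
     (\<Sum>i\<in>UNIV. complex_of_real (p i x) *
        (LBINT t:{0..1}. f (t *\<^sub>R x + (1 - t) *\<^sub>R simplex_vertex i)))"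

definition simplex_borel :: "(real ^ 'd) measure" where
  "simplex_borel = restrict_space borel simplex_set"

definition bounded_measurable_on_simplex :: "(real ^ 'd \<Rightarrow> complex) \<Rightarrow> bool" where
  "bounded_measurable_on_simplex f \<longleftrightarrow>
     f \<in> borel_measurable simplex_borel \<and> bounded (f ` simplex_set)"

definition invariant_probability ::
  "((real ^ 'd \<Rightarrow> complex) \<Rightarrow> real ^ 'd \<Rightarrow> complex) \<Rightarrow> (real ^ 'd) measure \<Rightarrow> bool" where
  "invariant_probability P \<nu> \<longleftrightarrow>
     prob_space \<nu> \<and> sets \<nu> = sets simplex_borel \<and>
     (\<forall>f. bounded_measurable_on_simplex f \<longrightarrow> (\<integral>x. P f x \<partial>\<nu>) = (\<integral>x. f x \<partial>\<nu>))"

definition holder_space :: "real \<Rightarrow> (real ^ 'd \<Rightarrow> complex) set" where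
  "holder_space \<alpha> =
     {f. \<exists>C. \<forall>x\<in>simplex_set. \<forall>y\<in>simplex_set. norm (f x - f y) \<le> C * norm (x - y) powr \<alpha>}"

definition holder_seminorm :: "real \<Rightarrow> (real ^ 'd \<Rightarrow> complex) \<Rightarrow> real" where
  "holder_seminorm \<alpha> f =
     (SUP (x, y) \<in> {(x, y). x \<in> simplex_set \<and> y \<in> simplex_set \<and> x \<noteq> y}.
        norm (f x - f y) / norm (x - y) powr \<alpha>)"

text \<open>Both suprema are suprema of nonempty sets of reals, bounded above whenever
  \<^term>\<open>f\<close> is Hoelder continuous of exponent \<^term>\<open>\<alpha>\<close> > 0.\<close>

definition holder_norm :: "real \<Rightarrow> (real ^ 'd \<Rightarrow> complex) \<Rightarrow> real" where
  "holder_norm \<alpha> f = (SUP x\<in>simplex_set. norm (f x)) + holder_seminorm \<alpha> f"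

end

theory Submission
  imports Defs
begin

text \<open>
  One step of the chain replaces the current point \<open>x\<close> by \<open>t x + (1 - t) e\<close>, where the pair
  of the uniform number \<open>t\<close> and the vertex \<open>e\<close> does not depend on \<open>x\<close>, because the weights are
  constant. Two chains driven by the same randomness therefore approach each other by the factor
  \<open>t\<close> at each step, and the expectation of \<open>t powr \<alpha>\<close> is \<open>1 / (1 + \<alpha>)\<close>. On the level of the
  operator: \<open>P\<close> multiplies Hoelder constants of exponent \<open>\<alpha>\<close> by at most \<open>1 / (1 + \<alpha>)\<close>
  (\<open>df_operator_contracts_holder_bound\<close>). The simplex has diameter at most 2, so
  \<open>P\<close> iterated \<open>n\<close> times on \<open>\<phi>\<close> oscillates by at most \<open>2 powr \<alpha> * (1 / (1 + \<alpha>)) ^ n\<close> times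
  the Hoelder constant of \<open>\<phi>\<close>. As its mean under any invariant probability is that of \<open>\<phi>\<close>, this
  gives the geometric rate, for every invariant probability
  (\<open>df_operator_power_converges_to_invariant\<close>).

  Uniqueness follows from the case \<open>\<alpha> = 1\<close>: two invariant probabilities give the same integral
  to each Lipschitz function, namely the limit of the iterates, and Lipschitz functions determine
  a finite measure (\<open>measure_eqI_lipschitz_integrals\<close>).

  Existence comes from running the random maps backwards. Composing independent copies of the
  random map with the newest one innermost, and applying them to the origin, leads to the series
  \<open>\<Sum>n. t_0 \<cdots> t_(n-1) (1 - t_n) e_n\<close>. Its weights have sum at most 1, so it converges for every
  choice of the \<open>t_n\<close> and \<open>e_n\<close>, to a point of the simplex. Putting a fresh pair \<open>(t, e)\<close> in front
  of the sequence turns the value \<open>Z\<close> of the series into \<open>t Z + (1 - t) e\<close>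
  (\<open>stick_series_case_nat\<close>) and does not change the law of the sequence; hence the law of
  \<open>Z\<close> is invariant (\<open>invariant_probability_stick_series\<close>).
\<close>

section \<open>Geometry of the simplex\<close>

lemma closed_simplex_set: "closed (simplex_set :: (real ^ 'd) set)"
  unfolding simplex_set_def
  by (intro closed_Collect_conj closed_Collect_all closed_Collect_le continuous_intros)

lemma simplex_vertex_in_simplex: "(simplex_vertex i :: real ^ 'd) \<in> simplex_set"
  by (cases i) (auto simp: simplex_set_def axis_def)

lemma convex_simplex_set: "convex (simplex_set :: (real ^ 'd) set)"
proof (rule convexI)
  fix x y :: "real ^ 'd" and u v :: real
  assume x: "x \<in> simplex_set" and y: "y \<in> simplex_set" and uv: "0 \<le> u" "0 \<le> v" "u + v = 1"
  have "(\<Sum>i\<in>UNIV. (u *\<^sub>R x + v *\<^sub>R y) $ i) = u * (\<Sum>i\<in>UNIV. x $ i) + v * (\<Sum>i\<in>UNIV. y $ i)"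
    by (simp add: sum.distrib sum_distrib_left)
  also have "\<dots> \<le> 1"
    using x y uv by (intro convex_bound_le) (auto simp: simplex_set_def)
  finally show "u *\<^sub>R x + v *\<^sub>R y \<in> simplex_set"
    using x y uv by (auto simp: simplex_set_def)
qed

lemma segment_to_vertex_in_simplex:
  assumes "x \<in> simplex_set" "0 \<le> t" "t \<le> 1"
  shows "t *\<^sub>R x + (1 - t) *\<^sub>R simplex_vertex i \<in> (simplex_set :: (real ^ 'd) set)"
  using assms by (intro convexD convex_simplex_set simplex_vertex_in_simplex) auto

lemma norm_le_1_if_in_simplex:
  assumes "x \<in> (simplex_set :: (real ^ 'd) set)"
  shows "norm x \<le> 1"
proof -
  have "norm x \<le> (\<Sum>i\<in>UNIV. \<bar>x $ i\<bar>)"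
    by (rule norm_le_l1_cart)
  also have "\<dots> = (\<Sum>i\<in>UNIV. x $ i)"
    using assms by (intro sum.cong) (auto simp: simplex_set_def)
  also have "\<dots> \<le> 1"
    using assms by (simp add: simplex_set_def)
  finally show ?thesis .
qed

lemma norm_diff_le_2_if_in_simplex:
  assumes "x \<in> (simplex_set :: (real ^ 'd) set)" "y \<in> simplex_set"
  shows "norm (x - y) \<le> 2"
  using norm_triangle_ineq4[of x y] norm_le_1_if_in_simplex[OF assms(1)]
    norm_le_1_if_in_simplex[OF assms(2)] by linarith

lemma compact_simplex_set: "compact (simplex_set :: (real ^ 'd) set)"
  unfolding compact_eq_bounded_closed
  by (auto intro!: closed_simplex_set boundedI[of _ 1] norm_le_1_if_in_simplex)

lemma space_simplex_borel: "space simplex_borel = simplex_set"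
  by (simp add: simplex_borel_def space_restrict_space)


section \<open>Contraction of Hoelder constants\<close>

text \<open>An explicit Hoelder constant, not necessarily the best one, is easier to carry through
  iterations of the operator than the supremum \<^const>\<open>holder_seminorm\<close>.\<close>

definition holder_bound :: "real \<Rightarrow> real \<Rightarrow> (real ^ 'd \<Rightarrow> complex) \<Rightarrow> bool" where
  "holder_bound \<alpha> C f \<longleftrightarrow>
     (\<forall>x\<in>simplex_set. \<forall>y\<in>simplex_set. norm (f x - f y) \<le> C * norm (x - y) powr \<alpha>)"

lemma holder_boundD:
  "holder_bound \<alpha> C f \<Longrightarrow> x \<in> simplex_set \<Longrightarrow> y \<in> simplex_set \<Longrightarrow>
     norm (f x - f y) \<le> C * norm (x - y) powr \<alpha>"
  by (simp add: holder_bound_def)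

lemma holder_bound_imp_continuous_on:
  fixes f :: "real ^ 'd \<Rightarrow> complex"
  assumes "holder_bound \<alpha> C f" "0 < \<alpha>"
  shows "continuous_on simplex_set f"
  unfolding continuous_on_def
proof
  fix x :: "real ^ 'd" assume x: "x \<in> simplex_set"
  have "((\<lambda>y. C * norm (y - x) powr \<alpha>) \<longlongrightarrow> C * norm (x - x) powr \<alpha>) (at x within simplex_set)"
    using \<open>0 < \<alpha>\<close> by (intro tendsto_intros) auto
  then have "((\<lambda>y. C * norm (y - x) powr \<alpha>) \<longlongrightarrow> 0) (at x within simplex_set)"
    using \<open>0 < \<alpha>\<close> by simp
  then have "((\<lambda>y. f y - f x) \<longlongrightarrow> 0) (at x within simplex_set)"
    by (rule Lim_null_comparison[rotated])
       (use x assms(1) in \<open>auto simp: eventually_at_filter holder_bound_def\<close>)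
  then show "(f \<longlongrightarrow> f x) (at x within simplex_set)"
    by (simp add: LIM_zero_iff)
qed

lemma holder_bound_imp_bounded_measurable:
  fixes f :: "real ^ 'd \<Rightarrow> complex"
  assumes "holder_bound \<alpha> C f" "0 < \<alpha>"
  shows "bounded_measurable_on_simplex f"
  using holder_bound_imp_continuous_on[OF assms]
  by (simp add: bounded_measurable_on_simplex_def simplex_borel_def
      borel_measurable_continuous_on_restrict compact_imp_bounded compact_continuous_image
      compact_simplex_set)

lemma set_integrable_powr_01:
  fixes \<alpha> :: real
  assumes "0 < \<alpha>"
  shows "set_integrable lborel {0..1} (\<lambda>t::real. t powr \<alpha>)"
  using assms by (intro borel_integrable_atLeastAtMost' continuous_on_powr' continuous_intros) auto

lemma set_integral_powr_01:
  fixes \<alpha> :: real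
  assumes "0 < \<alpha>"
  shows "(LBINT t:{0..1}. t powr \<alpha>) = 1 / (1 + \<alpha>)"
proof -
  have "((\<lambda>t. t powr \<alpha>) has_integral 1 / (1 + \<alpha>)) {0..1}"
    using has_integral_powr_from_0[of \<alpha> 1] assms by (simp add: add.commute)
  then show ?thesis
    using set_borel_integral_eq_integral(2)[OF set_integrable_powr_01[OF assms]]
    by (simp add: integral_unique)
qed

text \<open>Running from \<open>x\<close> and from \<open>y\<close> with the same \<open>t\<close> and the same vertex gives points at distance
  \<open>t * norm (x - y)\<close>. The weights of the vertices are the same at \<open>x\<close> and at \<open>y\<close>, so the values of
  the operator are compared branch by branch, and each branch contributes
  \<open>\<integral> t powr \<alpha> = 1 / (1 + \<alpha>)\<close>.\<close>

lemma df_operator_contracts_holder_bound: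
  fixes p :: "'d::finite option \<Rightarrow> real"
  assumes p: "\<And>i. p i \<ge> 0" "(\<Sum>i\<in>UNIV. p i) = 1" and "0 < \<alpha>" and f: "holder_bound \<alpha> C f"
  shows "holder_bound \<alpha> (C / (1 + \<alpha>)) (df_operator (\<lambda>i x. p i) f)"
  unfolding holder_bound_def
proof (intro ballI)
  fix x y :: "real ^ 'd" assume x: "x \<in> simplex_set" and y: "y \<in> simplex_set"
  define g where "g i z t = f (t *\<^sub>R z + (1 - t) *\<^sub>R simplex_vertex i)" for i z and t :: real
  have g_int: "set_integrable lborel {0..1} (g i z)" if "z \<in> simplex_set" for i z
    unfolding g_def
    by (rule borel_integrable_atLeastAtMost',
        rule continuous_on_compose2[OF holder_bound_imp_continuous_on[OF f \<open>0 < \<alpha>\<close>]])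
       (auto intro!: continuous_intros segment_to_vertex_in_simplex that)
  \<comment> \<open>The bound for \<open>norm (f x - f y)\<close> itself, before the contraction.\<close>
  define D where "D = C * norm (x - y) powr \<alpha>"
  have branch: "norm ((LBINT t:{0..1}. g i x t) - (LBINT t:{0..1}. g i y t)) \<le> D / (1 + \<alpha>)" for i
  proof -
    have "norm ((LBINT t:{0..1}. g i x t) - (LBINT t:{0..1}. g i y t))
            = norm (LBINT t:{0..1}. g i x t - g i y t)"
      using g_int x y by simp
    also have "\<dots> \<le> (LBINT t:{0..1}. norm (g i x t - g i y t))"
      using g_int x y by (intro set_integral_norm_bound set_integral_diff)
    also have "\<dots> \<le> (LBINT t:{0..1}. D * t powr \<alpha>)"
    proof (rule set_integral_mono)
      show "set_integrable lborel {0..1} (\<lambda>t. norm (g i x t - g i y t))"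
        using g_int x y by (intro set_integrable_norm set_integral_diff)
      show "set_integrable lborel {0..1} (\<lambda>t. D * t powr \<alpha>)"
        using set_integrable_powr_01[OF \<open>0 < \<alpha>\<close>] by simp
      fix t :: real assume t: "t \<in> {0..1}"
      have "t *\<^sub>R x + (1 - t) *\<^sub>R simplex_vertex i - (t *\<^sub>R y + (1 - t) *\<^sub>R simplex_vertex i)
              = t *\<^sub>R (x - y)"
        by (simp add: scaleR_diff_right)
      then have "norm (g i x t - g i y t) \<le> C * norm (t *\<^sub>R (x - y)) powr \<alpha>"
        unfolding g_def
        using holder_boundD[OF f segment_to_vertex_in_simplex[OF x, of t i]
            segment_to_vertex_in_simplex[OF y, of t i]] t by simp
      also have "\<dots> = D * t powr \<alpha>"
        using t by (simp add: D_def powr_mult)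
      finally show "norm (g i x t - g i y t) \<le> D * t powr \<alpha>" .
    qed
    also have "\<dots> = D / (1 + \<alpha>)"
      using set_integral_powr_01[OF \<open>0 < \<alpha>\<close>] by simp
    finally show ?thesis .
  qed
  have "norm (df_operator (\<lambda>i x. p i) f x - df_operator (\<lambda>i x. p i) f y)
      = norm (\<Sum>i\<in>UNIV. complex_of_real (p i) *
          ((LBINT t:{0..1}. g i x t) - (LBINT t:{0..1}. g i y t)))"
    by (simp add: df_operator_def g_def sum_subtractf right_diff_distrib)
  also have "\<dots> \<le> (\<Sum>i\<in>UNIV. p i * (D / (1 + \<alpha>)))"
    using p(1) branch by (intro sum_norm_le) (simp add: norm_mult mult_left_mono del: times_divide_eq_right)
  also have "\<dots> = D / (1 + \<alpha>)"
    by (simp only: p(2) mult_1_left flip: sum_distrib_right)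
  finally show "norm (df_operator (\<lambda>i x. p i) f x - df_operator (\<lambda>i x. p i) f y)
      \<le> C / (1 + \<alpha>) * norm (x - y) powr \<alpha>"
    by (simp add: D_def)
qed

lemma df_operator_power_contracts_holder_bound:
  fixes p :: "'d::finite option \<Rightarrow> real"
  assumes "\<And>i. p i \<ge> 0" "(\<Sum>i\<in>UNIV. p i) = 1" "0 < \<alpha>" "holder_bound \<alpha> C f"
  shows "holder_bound \<alpha> (C * (1 / (1 + \<alpha>)) ^ n) ((df_operator (\<lambda>i x. p i) ^^ n) f)"
proof (induction n)
  case (Suc n)
  show ?case
    using df_operator_contracts_holder_bound[OF assms(1-3) Suc] by (simp add: field_simps)
qed (use assms in simp)

text \<open>Invariance lets \<open>\<integral> f\<close> be replaced by \<open>\<integral> P ^^ n f\<close>, so the difference is an average of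
  \<open>(P ^^ n) f x - (P ^^ n) f y\<close> over \<open>y\<close>, which the contracted Hoelder constant and the diameter
  bound 2 control.\<close>

lemma df_operator_power_converges_to_invariant:
  fixes p :: "'d::finite option \<Rightarrow> real"
  assumes p: "\<And>i. p i \<ge> 0" "(\<Sum>i\<in>UNIV. p i) = 1" and "0 < \<alpha>"
    and f: "holder_bound \<alpha> C f" and "0 \<le> C"
    and inv: "invariant_probability (df_operator (\<lambda>i x. p i)) \<mu>" and x: "x \<in> simplex_set"
  shows "norm ((df_operator (\<lambda>i x. p i) ^^ n) f x - (\<integral>y. f y \<partial>\<mu>))
           \<le> C * (1 / (1 + \<alpha>)) ^ n * 2 powr \<alpha>"
proof -
  let ?P = "df_operator (\<lambda>i x. p i)"
  interpret prob_space \<mu>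
    using inv by (simp add: invariant_probability_def)
  have sets: "sets \<mu> = sets simplex_borel"
    using inv by (simp add: invariant_probability_def)
  then have space: "space \<mu> = simplex_set"
    using sets_eq_imp_space_eq space_simplex_borel by metis
  have hb: "holder_bound \<alpha> (C * (1 / (1 + \<alpha>)) ^ k) ((?P ^^ k) f)" for k
    by (intro df_operator_power_contracts_holder_bound assms)
  have bm: "bounded_measurable_on_simplex ((?P ^^ k) f)" for k
    by (rule holder_bound_imp_bounded_measurable[OF hb \<open>0 < \<alpha>\<close>])
  have int: "integrable \<mu> ((?P ^^ n) f)"
  proof -
    obtain B where "\<And>y. y \<in> simplex_set \<Longrightarrow> norm ((?P ^^ n) f y) \<le> B"
      using bm[of n] by (auto simp: bounded_measurable_on_simplex_def bounded_iff)
    then show ?thesis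
      using bm[of n] space sets
      by (intro integrable_const_bound[of _ B])
         (auto simp: bounded_measurable_on_simplex_def cong: measurable_cong_sets)
  qed
  have "(\<integral>y. (?P ^^ k) f y \<partial>\<mu>) = (\<integral>y. f y \<partial>\<mu>)" for k
    using bm inv by (induction k) (auto simp: invariant_probability_def)
  then have "(?P ^^ n) f x - (\<integral>y. f y \<partial>\<mu>) = (\<integral>y. (?P ^^ n) f x - (?P ^^ n) f y \<partial>\<mu>)"
    using int by (simp add: prob_space)
  also have "norm \<dots> \<le> (\<integral>y. norm ((?P ^^ n) f x - (?P ^^ n) f y) \<partial>\<mu>)"
    by (rule integral_norm_bound)
  also have "\<dots> \<le> (\<integral>y. C * (1 / (1 + \<alpha>)) ^ n * 2 powr \<alpha> \<partial>\<mu>)"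
  proof (rule integral_mono)
    fix y assume "y \<in> space \<mu>"
    then have y: "y \<in> simplex_set"
      by (simp add: space)
    have "norm ((?P ^^ n) f x - (?P ^^ n) f y) \<le> C * (1 / (1 + \<alpha>)) ^ n * norm (x - y) powr \<alpha>"
      by (rule holder_boundD[OF hb x y])
    also have "\<dots> \<le> C * (1 / (1 + \<alpha>)) ^ n * 2 powr \<alpha>"
      using norm_diff_le_2_if_in_simplex[OF x y] \<open>0 \<le> C\<close> \<open>0 < \<alpha>\<close>
      by (intro mult_left_mono powr_mono2) auto
    finally show "norm ((?P ^^ n) f x - (?P ^^ n) f y) \<le> C * (1 / (1 + \<alpha>)) ^ n * 2 powr \<alpha>" .
  qed (use int in auto)
  finally show ?thesis
    by (simp add: prob_space)
qed


section \<open>Lipschitz functions determine a measure\<close>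

text \<open>These tent functions around \<open>K\<close> are Lipschitz and take values in the unit interval, so dominated
  convergence carries equality of integrals over to closed sets.\<close>

lemma indicator_closed_limit_of_lipschitz:
  fixes K :: "'a::metric_space set" and x :: 'a
  assumes "closed K" "K \<noteq> {}"
  shows "(\<lambda>k. max 0 (1 - real k * infdist x K)) \<longlonglongrightarrow> indicator K x"
proof (cases "x \<in> K")
  case False
  then have "0 < infdist x K"
    using assms in_closed_iff_infdist_zero[of K x] infdist_nonneg[of x K] by linarith
  then obtain N :: nat where N: "1 < real N * infdist x K"
    using reals_Archimedean3 by blast
  have "max 0 (1 - real k * infdist x K) = 0" if "k \<ge> N" for k
  proof -
    have "real N * infdist x K \<le> real k * infdist x K"
      using that by (intro mult_right_mono infdist_nonneg) auto
    then show ?thesis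
      using N by simp
  qed
  then have "eventually (\<lambda>k. max 0 (1 - real k * infdist x K) = 0) sequentially"
    by (auto simp: eventually_sequentially)
  then show ?thesis
    using False by (simp add: tendsto_eventually)
qed simp

text \<open>The closed subsets of \<open>S\<close> are stable under intersection and generate the Borel sets of \<open>S\<close>, so it
  is enough to compare the measures there, where both are limits of integrals of tent functions.\<close>

lemma measure_eqI_lipschitz_integrals:
  fixes M N :: "'a::metric_space measure" and S :: "'a set"
  assumes "closed S" "finite_measure M" "finite_measure N"
    and sets: "sets M = sets (restrict_space borel S)" "sets N = sets (restrict_space borel S)"
    and eq: "\<And>(f :: 'a \<Rightarrow> real) L. L-lipschitz_on UNIV f \<Longrightarrow> (\<integral>x. f x \<partial>M) = (\<integral>x. f x \<partial>N)"
  shows "M = N"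
proof -
  interpret M: finite_measure M by fact
  interpret N: finite_measure N by fact
  have space: "space M = S" "space N = S"
    using sets[THEN sets_eq_imp_space_eq] by (auto simp: space_restrict_space)
  have gen: "sets (restrict_space borel S) = sigma_sets S ((\<inter>) S ` Collect closed)"
  proof -
    have "(\<inter>) S ` sigma_sets UNIV (Collect closed) = sigma_sets S ((\<inter>) S ` Collect closed)"
      using \<open>closed S\<close> by (intro sigma_sets_Int) auto
    then show ?thesis
      by (simp add: sets_restrict_space borel_eq_closed)
  qed
  have closed_measure: "(\<lambda>k. \<integral>x. max 0 (1 - real k * infdist x K) \<partial>Q) \<longlonglongrightarrow> measure Q K"
    if Q: "finite_measure Q" "sets Q = sets (restrict_space borel S)"
      and K: "closed K" "K \<noteq> {}" "K \<subseteq> S" for Q :: "'a measure" and K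
  proof -
    interpret Q: finite_measure Q by fact
    have KQ: "K \<in> sets Q"
      using K \<open>closed S\<close> unfolding Q(2) by (auto simp: sets_restrict_space)
    have "(\<lambda>k. \<integral>x. max 0 (1 - real k * infdist x K) \<partial>Q) \<longlonglongrightarrow> (\<integral>x. indicator K x \<partial>Q)"
    proof (rule integral_dominated_convergence[where w = "\<lambda>_. 1"])
      fix k
      have "(\<lambda>x. max 0 (1 - real k * infdist x K)) \<in> borel_measurable (restrict_space borel S)"
        by (intro borel_measurable_continuous_on_restrict continuous_intros)
      then show "(\<lambda>x. max 0 (1 - real k * infdist x K)) \<in> borel_measurable Q"
        by (simp add: Q(2) cong: measurable_cong_sets)
    qed (use KQ K in \<open>auto intro!: indicator_closed_limit_of_lipschitz simp: infdist_nonneg\<close>)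
    then show ?thesis
      using KQ by simp
  qed
  show ?thesis
  proof (rule measure_eqI_generator_eq[where E = "(\<inter>) S ` Collect closed" and \<Omega> = S and A = "\<lambda>_. S"])
    show "Int_stable ((\<inter>) S ` Collect closed)"
    proof (rule Int_stableI)
      fix A B assume "A \<in> (\<inter>) S ` Collect closed" "B \<in> (\<inter>) S ` Collect closed"
      then have "A \<inter> B = S \<inter> (A \<inter> B)" "closed (A \<inter> B)"
        using \<open>closed S\<close> by auto
      then show "A \<inter> B \<in> (\<inter>) S ` Collect closed"
        by blast
    qed
    fix K assume "K \<in> (\<inter>) S ` Collect closed"
    then have K: "closed K" "K \<subseteq> S"
      using \<open>closed S\<close> by auto
    show "emeasure M K = emeasure N K"
    proof (cases "K = {}")
      case False
      have "(\<integral>x. max 0 (1 - real k * infdist x K) \<partial>M) = (\<integral>x. max 0 (1 - real k * infdist x K) \<partial>N)" for k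
      proof (rule eq)
        show "(real k)-lipschitz_on UNIV (\<lambda>x. max 0 (1 - real k * infdist x K))"
        proof (rule lipschitz_onI)
          fix x y
          have "dist (max 0 (1 - real k * infdist x K)) (max 0 (1 - real k * infdist y K))
                  \<le> \<bar>real k * infdist x K - real k * infdist y K\<bar>"
            by (auto simp: dist_real_def max_def)
          also have "\<dots> = real k * \<bar>infdist x K - infdist y K\<bar>"
            by (simp add: abs_mult flip: right_diff_distrib)
          also have "\<dots> \<le> real k * dist x y"
            by (intro mult_left_mono infdist_triangle_abs) auto
          finally show "dist (max 0 (1 - real k * infdist x K)) (max 0 (1 - real k * infdist y K))
                  \<le> real k * dist x y" .
        qed simp
      qed
      then have "measure M K = measure N K"
        using closed_measure[OF assms(2) sets(1) K(1) False K(2)]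
          closed_measure[OF assms(3) sets(2) K(1) False K(2)] LIMSEQ_unique by simp
      then show ?thesis
        by (simp add: M.emeasure_eq_measure N.emeasure_eq_measure)
    qed simp
  next
    show "range (\<lambda>_::nat. S) \<subseteq> (\<inter>) S ` Collect closed"
      by auto
  qed (use sets gen in auto)
qed

text \<open>Both integrals of a Lipschitz function are the limit of its iterates at one and the same point.\<close>

lemma invariant_probability_unique:
  fixes p :: "'d::finite option \<Rightarrow> real"
  assumes p: "\<And>i. p i \<ge> 0" "(\<Sum>i\<in>UNIV. p i) = 1"
    and inv: "invariant_probability (df_operator (\<lambda>i x. p i)) \<mu>"
             "invariant_probability (df_operator (\<lambda>i x. p i)) \<nu>"
  shows "\<mu> = \<nu>"
proof (rule measure_eqI_lipschitz_integrals[OF closed_simplex_set])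
  show "finite_measure \<mu>" "finite_measure \<nu>"
    "sets \<mu> = sets (restrict_space borel simplex_set)"
    "sets \<nu> = sets (restrict_space borel simplex_set)"
    using inv by (auto simp: invariant_probability_def simplex_borel_def prob_space.finite_measure)
  fix f :: "real ^ 'd \<Rightarrow> real" and L
  assume L: "L-lipschitz_on UNIV f"
  let ?f = "\<lambda>x. complex_of_real (f x)" and ?P = "df_operator (\<lambda>i x. p i)"
  have hb: "holder_bound 1 L ?f"
    using lipschitz_onD[OF L]
    by (simp add: holder_bound_def dist_norm flip: of_real_diff)
  have lim: "(\<lambda>n. (?P ^^ n) ?f 0) \<longlonglongrightarrow> (\<integral>y. ?f y \<partial>\<xi>)" if "invariant_probability ?P \<xi>" for \<xi>
  proof -
    have "(\<lambda>n. L * (1 / (1 + 1)) ^ n * 2 powr 1) \<longlonglongrightarrow> 0"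
      by (auto intro!: tendsto_mult_right_zero tendsto_mult_left_zero LIMSEQ_power_zero)
    then have "(\<lambda>n. (?P ^^ n) ?f 0 - (\<integral>y. ?f y \<partial>\<xi>)) \<longlonglongrightarrow> 0"
    proof (rule Lim_null_comparison[rotated], intro always_eventually allI)
      show "norm ((?P ^^ n) ?f 0 - (\<integral>y. ?f y \<partial>\<xi>)) \<le> L * (1 / (1 + 1)) ^ n * 2 powr 1" for n
        using simplex_vertex_in_simplex[of None]
        by (intro df_operator_power_converges_to_invariant p hb that lipschitz_on_nonneg[OF L]) auto
    qed
    then show ?thesis
      by (simp add: LIM_zero_iff)
  qed
  have "(\<integral>y. ?f y \<partial>\<mu>) = (\<integral>y. ?f y \<partial>\<nu>)"
    using lim[OF inv(1)] lim[OF inv(2)] by (rule LIMSEQ_unique)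
  then show "(\<integral>x. f x \<partial>\<mu>) = (\<integral>x. f x \<partial>\<nu>)"
    by (simp add: integral_complex_of_real)
qed


section \<open>The random series\<close>

text \<open>The limit of the images of the origin under the random maps \<open>x \<mapsto> t x + (1 - t) e\<close> composed with
  the first one outermost.
  The weights are the pieces obtained by breaking a stick of length 1 again and again: piece \<open>n\<close> is
  the fraction \<open>1 - t_n\<close> of what the earlier breaks have left.\<close>

definition stick_series :: "(nat \<Rightarrow> real \<times> 'd option) \<Rightarrow> real ^ 'd" where
  "stick_series \<omega> =
     (\<Sum>n. ((\<Prod>k<n. fst (\<omega> k)) * (1 - fst (\<omega> n))) *\<^sub>R simplex_vertex (snd (\<omega> n)))"

text \<open>The pieces broken off and the remaining stick add up to the whole stick.\<close>

lemma sum_stick_weights: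
  fixes t :: "nat \<Rightarrow> real"
  shows "(\<Sum>n<m. (\<Prod>k<n. t k) * (1 - t n)) = 1 - (\<Prod>k<m. t k)"
  by (induction m) (simp_all add: algebra_simps)

context
  fixes \<omega> :: "nat \<Rightarrow> real \<times> 'd::finite option"
  assumes unit: "\<And>n. fst (\<omega> n) \<in> {0..1}"
begin

lemma stick_weight_nonneg: "0 \<le> (\<Prod>k<n. fst (\<omega> k)) * (1 - fst (\<omega> n))"
  using unit by (auto intro!: mult_nonneg_nonneg prod_nonneg)

lemma sum_stick_weights_le_1: "(\<Sum>n<m. (\<Prod>k<n. fst (\<omega> k)) * (1 - fst (\<omega> n))) \<le> 1"
  using unit by (simp add: sum_stick_weights prod_nonneg)

lemma summable_stick_series:
  "summable (\<lambda>n. ((\<Prod>k<n. fst (\<omega> k)) * (1 - fst (\<omega> n))) *\<^sub>R (simplex_vertex (snd (\<omega> n)) :: real ^ 'd))"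
proof (rule summable_comparison_test')
  show "summable (\<lambda>n. (\<Prod>k<n. fst (\<omega> k)) * (1 - fst (\<omega> n)))"
    using stick_weight_nonneg sum_stick_weights_le_1 by (rule summableI_nonneg_bounded)
  fix n :: nat
  show "norm (((\<Prod>k<n. fst (\<omega> k)) * (1 - fst (\<omega> n))) *\<^sub>R (simplex_vertex (snd (\<omega> n)) :: real ^ 'd))
      \<le> (\<Prod>k<n. fst (\<omega> k)) * (1 - fst (\<omega> n))"
    using mult_left_mono[OF norm_le_1_if_in_simplex[OF simplex_vertex_in_simplex]
        stick_weight_nonneg[of n]] stick_weight_nonneg[of n]
    by (simp only: norm_scaleR abs_of_nonneg mult_1_right)
qed

lemma stick_series_in_simplex: "stick_series \<omega> \<in> simplex_set"
proof (rule closed_sequentially[OF closed_simplex_set])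
  let ?w = "\<lambda>n. (\<Prod>k<n. fst (\<omega> k)) * (1 - fst (\<omega> n))"
  let ?v = "\<lambda>n. simplex_vertex (snd (\<omega> n)) :: real ^ 'd"
  show "(\<lambda>m. \<Sum>n<m. ?w n *\<^sub>R ?v n) \<longlonglongrightarrow> stick_series \<omega>"
    unfolding stick_series_def by (rule summable_LIMSEQ[OF summable_stick_series])
  fix m
  have v: "0 \<le> ?v n $ i" "(\<Sum>i\<in>UNIV. ?v n $ i) \<le> 1" for n i
    using simplex_vertex_in_simplex[of "snd (\<omega> n)"] by (auto simp: simplex_set_def)
  have "(\<Sum>i\<in>UNIV. (\<Sum>n<m. ?w n *\<^sub>R ?v n) $ i) = (\<Sum>n<m. ?w n * (\<Sum>i\<in>UNIV. ?v n $ i))"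
    by (simp add: sum_distrib_left sum.swap[of _ "{..<m}"])
  also have "\<dots> \<le> (\<Sum>n<m. ?w n * 1)"
    by (intro sum_mono mult_left_mono v stick_weight_nonneg)
  also have "\<dots> \<le> 1"
    using sum_stick_weights_le_1 by simp
  finally have "(\<Sum>i\<in>UNIV. (\<Sum>n<m. ?w n *\<^sub>R ?v n) $ i) \<le> 1" .
  moreover have "0 \<le> (\<Sum>n<m. ?w n *\<^sub>R ?v n) $ i" for i
    using mult_nonneg_nonneg[OF stick_weight_nonneg v(1)] by (simp add: sum_nonneg)
  ultimately show "(\<Sum>n<m. ?w n *\<^sub>R ?v n) \<in> simplex_set"
    by (simp add: simplex_set_def)
qed

end

text \<open>The random form of invariance: the vertex placed in front has weight \<open>1 - t\<close>, and
  every later weight gains the factor \<open>t\<close>.\<close>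

lemma stick_series_case_nat:
  fixes \<omega> :: "nat \<Rightarrow> real \<times> 'd::finite option"
  assumes "\<And>n. fst (\<omega> n) \<in> {0..1}" "fst s \<in> {0..1}"
  shows "stick_series (case_nat s \<omega>)
           = fst s *\<^sub>R stick_series \<omega> + (1 - fst s) *\<^sub>R simplex_vertex (snd s)"
proof -
  let ?a = "\<lambda>\<omega> n. ((\<Prod>k<n. fst (\<omega> k)) * (1 - fst (\<omega> n))) *\<^sub>R (simplex_vertex (snd (\<omega> n)) :: real ^ 'd)"
  have "fst (case_nat s \<omega> n) \<in> {0..1}" for n
    using assms by (cases n) auto
  then have "summable (?a (case_nat s \<omega>))"
    by (rule summable_stick_series)
  then have head: "(\<Sum>n. ?a (case_nat s \<omega>) (Suc n)) = stick_series (case_nat s \<omega>) - ?a (case_nat s \<omega>) 0"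
    unfolding stick_series_def by (rule suminf_split_head)
  have tail: "?a (case_nat s \<omega>) (Suc n) = fst s *\<^sub>R ?a \<omega> n" for n
    by (simp add: prod.lessThan_Suc_shift mult.assoc del: prod.lessThan_Suc)
  have "(\<Sum>n. fst s *\<^sub>R ?a \<omega> n) = fst s *\<^sub>R stick_series \<omega>"
    unfolding stick_series_def
    by (intro suminf_scaleR_right[symmetric] summable_stick_series assms(1))
  then have "stick_series (case_nat s \<omega>) - ?a (case_nat s \<omega>) 0 = fst s *\<^sub>R stick_series \<omega>"
    using head by (simp only: tail)
  then show ?thesis
    by (simp add: algebra_simps)
qed


section \<open>Existence of an invariant probability\<close>

text \<open>The uniform law is placed on a space consisting of the unit interval only, not on the real line
  with a density, so that every point of the sample space, and not just almost every one, keeps the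
  chain in the simplex.\<close>

definition step_law :: "('d::finite option \<Rightarrow> real) \<Rightarrow> (real \<times> 'd option) measure" where
  "step_law p = restrict_space lborel {0..1} \<Otimes>\<^sub>M measure_pmf (embed_pmf p)"

lemma prob_space_uniform_01: "prob_space (restrict_space lborel {0..1::real})"
  by (intro prob_space_restrict_space) auto

lemma prob_space_step_law: "prob_space (step_law p)"
  unfolding step_law_def
  by (intro prob_space_pair prob_space_uniform_01 prob_space_measure_pmf)

lemma fst_in_01_if_in_space_step_law: "s \<in> space (step_law p) \<Longrightarrow> fst s \<in> {0..1}"
  by (auto simp: step_law_def space_pair_measure space_restrict_space)

lemma measurable_fst_step_law [measurable]: "fst \<in> borel_measurable (step_law p)"
proof -
  have "(\<lambda>t. t) \<in> borel_measurable (restrict_space lborel {0..1::real})"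
    by (intro measurable_restrict_space1) simp
  then show ?thesis
    unfolding step_law_def by (rule measurable_compose[OF measurable_fst])
qed

lemma measurable_vertex_step_law [measurable]:
  "(\<lambda>s. simplex_vertex (snd s) :: real ^ 'd::finite) \<in> borel_measurable (step_law p)"
  unfolding step_law_def by (rule measurable_compose[OF measurable_snd]) simp

lemma integral_step_law:
  fixes p :: "'d::finite option \<Rightarrow> real" and F :: "real \<times> 'd option \<Rightarrow> complex"
  assumes p: "\<And>i. p i \<ge> 0" "(\<Sum>i\<in>UNIV. p i) = 1"
    and F: "F \<in> borel_measurable (step_law p)" "\<And>s. s \<in> space (step_law p) \<Longrightarrow> norm (F s) \<le> B"
  shows "(\<integral>s. F s \<partial>step_law p) = (\<Sum>i\<in>UNIV. complex_of_real (p i) * (LBINT t:{0..1}. F (t, i)))"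
proof -
  let ?U = "restrict_space lborel {0..1::real}" and ?V = "measure_pmf (embed_pmf p)"
  interpret U: prob_space ?U
    by (rule prob_space_uniform_01)
  interpret UV: pair_prob_space ?U ?V ..
  interpret L: prob_space "step_law p"
    by (rule prob_space_step_law)
  have "integrable (step_law p) F"
    using F by (intro L.integrable_const_bound[of _ B]) auto
  then have "(\<integral>s. F s \<partial>step_law p) = (\<integral>i. \<integral>t. F (t, i) \<partial>?U \<partial>?V)"
    unfolding step_law_def by (subst UV.integral_snd) auto
  also have "\<dots> = (\<Sum>i\<in>UNIV. pmf (embed_pmf p) i *\<^sub>R (\<integral>t. F (t, i) \<partial>?U))"
    by (rule integral_measure_pmf) auto
  also have "\<dots> = (\<Sum>i\<in>UNIV. complex_of_real (p i) * (LBINT t:{0..1}. F (t, i)))"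
  proof (rule sum.cong)
    fix i
    have "(\<integral>\<^sup>+i. ennreal (p i) \<partial>count_space UNIV) = 1"
      using p by (simp add: nn_integral_count_space_finite)
    then have "pmf (embed_pmf p) i = p i"
      using p(1) by (intro pmf_embed_pmf) auto
    then show "pmf (embed_pmf p) i *\<^sub>R (\<integral>t. F (t, i) \<partial>?U)
        = complex_of_real (p i) * (LBINT t:{0..1}. F (t, i))"
      by (simp add: integral_restrict_space set_lebesgue_integral_def scaleR_conv_of_real)
  qed simp
  finally show ?thesis .
qed

lemma measurable_step [measurable]:
  "(\<lambda>(x, s). fst s *\<^sub>R x + (1 - fst s) *\<^sub>R simplex_vertex (snd s))
     \<in> simplex_borel \<Otimes>\<^sub>M step_law p \<rightarrow>\<^sub>M (simplex_borel :: (real ^ 'd::finite) measure)"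
proof -
  have [measurable]: "(\<lambda>x. x) \<in> borel_measurable (simplex_borel :: (real ^ 'd) measure)"
    unfolding simplex_borel_def by (intro measurable_restrict_space1) simp
  have "(\<lambda>(x, s). fst s *\<^sub>R x + (1 - fst s) *\<^sub>R simplex_vertex (snd s))
     \<in> borel_measurable ((simplex_borel :: (real ^ 'd) measure) \<Otimes>\<^sub>M step_law p)"
    unfolding split_beta' by measurable
  then show ?thesis
    unfolding simplex_borel_def
    by (rule measurable_restrict_space2[rotated])
       (auto simp: space_pair_measure space_simplex_borel[unfolded simplex_borel_def]
         intro!: segment_to_vertex_in_simplex dest: fst_in_01_if_in_space_step_law)
qed

text \<open>The link between the operator and the random map: one step is a single integral against
  \<^const>\<open>step_law\<close>, so that Fubini's theorem applies to it as a whole.\<close>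

lemma df_operator_eq_integral_step_law:
  fixes p :: "'d::finite option \<Rightarrow> real"
  assumes p: "\<And>i. p i \<ge> 0" "(\<Sum>i\<in>UNIV. p i) = 1"
    and f: "bounded_measurable_on_simplex f" and x: "x \<in> simplex_set"
  shows "df_operator (\<lambda>i x. p i) f x
           = (\<integral>s. f (fst s *\<^sub>R x + (1 - fst s) *\<^sub>R simplex_vertex (snd s)) \<partial>step_law p)"
proof -
  obtain B where B: "\<And>y. y \<in> simplex_set \<Longrightarrow> norm (f y) \<le> B"
    using f by (auto simp: bounded_measurable_on_simplex_def bounded_iff)
  have [measurable]: "f \<in> borel_measurable simplex_borel"
    using f by (simp add: bounded_measurable_on_simplex_def)
  have [simp]: "x \<in> space simplex_borel"
    by (simp add: x space_simplex_borel)
  have "(\<lambda>s. (\<lambda>(x, s). fst s *\<^sub>R x + (1 - fst s) *\<^sub>R simplex_vertex (snd s)) (x, s))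
      \<in> step_law p \<rightarrow>\<^sub>M simplex_borel"
    by measurable
  then have "(\<lambda>s. f (fst s *\<^sub>R x + (1 - fst s) *\<^sub>R simplex_vertex (snd s)))
      \<in> borel_measurable (step_law p)"
    by simp
  then show ?thesis
    using x fst_in_01_if_in_space_step_law
    by (subst integral_step_law[OF p, where B = B])
       (auto simp: df_operator_def intro!: B segment_to_vertex_in_simplex)
qed

lemma borel_measurable_df_operator:
  fixes p :: "'d::finite option \<Rightarrow> real"
  assumes p: "\<And>i. p i \<ge> 0" "(\<Sum>i\<in>UNIV. p i) = 1" and f: "bounded_measurable_on_simplex f"
  shows "df_operator (\<lambda>i x. p i) f \<in> borel_measurable simplex_borel"
proof -
  interpret prob_space "step_law p"
    by (rule prob_space_step_law)
  have [measurable]: "f \<in> borel_measurable simplex_borel"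
    using f by (simp add: bounded_measurable_on_simplex_def)
  have "(\<lambda>z. f ((\<lambda>(x, s). fst s *\<^sub>R x + (1 - fst s) *\<^sub>R simplex_vertex (snd s)) z))
      \<in> borel_measurable (simplex_borel \<Otimes>\<^sub>M step_law p)"
    by measurable
  then have "(\<lambda>x. \<integral>s. f (fst s *\<^sub>R x + (1 - fst s) *\<^sub>R simplex_vertex (snd s)) \<partial>step_law p)
      \<in> borel_measurable simplex_borel"
    by (intro borel_measurable_lebesgue_integral) (simp add: split_beta')
  then show ?thesis
    by (subst measurable_cong[OF df_operator_eq_integral_step_law[OF p f]])
       (auto simp: space_simplex_borel)
qed

lemma measurable_stick_series:
  "(stick_series :: _ \<Rightarrow> real ^ 'd::finite) \<in> (\<Pi>\<^sub>M n\<in>(UNIV::nat set). step_law p) \<rightarrow>\<^sub>M simplex_borel"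
proof -
  have "(stick_series :: _ \<Rightarrow> real ^ 'd) \<in> borel_measurable (\<Pi>\<^sub>M n\<in>(UNIV::nat set). step_law p)"
    unfolding stick_series_def by measurable
  then show ?thesis
    unfolding simplex_borel_def
    by (rule measurable_restrict_space2[rotated])
       (auto simp: space_PiM PiE_iff intro!: stick_series_in_simplex
         dest: fst_in_01_if_in_space_step_law simp del: atLeastAtMost_iff)
qed

text \<open>The law of an i.i.d. sequence does not change when an independent copy of its entries is put in
  front (\<open>PiM_iter\<close>). Integrating a function of the series and splitting off the first entry by
  Fubini's theorem thus produces the operator applied to that function.\<close>

lemma invariant_probability_stick_series:
  fixes p :: "'d::finite option \<Rightarrow> real"
  assumes p: "\<And>i. p i \<ge> 0" "(\<Sum>i\<in>UNIV. p i) = 1"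
  shows "invariant_probability (df_operator (\<lambda>i x. p i))
           (distr (\<Pi>\<^sub>M n\<in>(UNIV::nat set). step_law p) simplex_borel stick_series)"
proof -
  interpret M: prob_space "step_law p"
    by (rule prob_space_step_law)
  interpret sequence_space "step_law p" ..
  interpret MS: pair_prob_space "step_law p" S ..
  note [measurable] = measurable_stick_series[of p]
  show ?thesis
    unfolding invariant_probability_def
  proof (intro conjI allI impI)
    show "prob_space (distr S simplex_borel stick_series)"
      by (rule prob_space_distr) simp
    fix f :: "real ^ 'd \<Rightarrow> complex" assume f: "bounded_measurable_on_simplex f"
    have fm[measurable]: "f \<in> borel_measurable simplex_borel"
      using f by (simp add: bounded_measurable_on_simplex_def)
    obtain B where B: "\<And>y. y \<in> simplex_set \<Longrightarrow> norm (f y) \<le> B"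
      using f by (auto simp: bounded_measurable_on_simplex_def bounded_iff)
    have series_in: "stick_series \<omega> \<in> simplex_set" if "\<omega> \<in> space S" for \<omega>
      using measurable_space[OF measurable_stick_series that] by (simp add: space_simplex_borel)
    have case_nat_meas [measurable]: "(\<lambda>(s, \<omega>). case_nat s \<omega>) \<in> step_law p \<Otimes>\<^sub>M S \<rightarrow>\<^sub>M S"
      by measurable
    \<comment> \<open>The value of \<open>f\<close> after one more step of the chain, started at the value of the series.\<close>
    define g where "g s \<omega> = f (fst s *\<^sub>R stick_series \<omega> + (1 - fst s) *\<^sub>R simplex_vertex (snd s))"
      for s \<omega>
    have shift: "f (stick_series (case_nat s \<omega>)) = g s \<omega>"
      if "s \<in> space (step_law p)" "\<omega> \<in> space S" for s \<omega>
      unfolding g_def using that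
      by (subst stick_series_case_nat)
         (auto simp: space_PiM PiE_iff dest: fst_in_01_if_in_space_step_law
           simp del: atLeastAtMost_iff)
    have "(\<lambda>z. f (stick_series (case z of (s, \<omega>) \<Rightarrow> case_nat s \<omega>)))
        \<in> borel_measurable (step_law p \<Otimes>\<^sub>M S)"
      by measurable
    then have "case_prod g \<in> borel_measurable (step_law p \<Otimes>\<^sub>M S)"
      by (rule measurable_cong[THEN iffD1, rotated]) (auto simp: space_pair_measure shift)
    moreover have "norm (case_prod g z) \<le> B" if z_in: "z \<in> space (step_law p \<Otimes>\<^sub>M S)" for z
    proof -
      obtain s \<omega> where z: "z = (s, \<omega>)" "s \<in> space (step_law p)" "\<omega> \<in> space S"
        using z_in by (auto simp: space_pair_measure)
      show ?thesis
        using fst_in_01_if_in_space_step_law[OF z(2)]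
        by (simp add: z(1) g_def B segment_to_vertex_in_simplex series_in[OF z(3)])
    qed
    ultimately have g_int: "integrable (step_law p \<Otimes>\<^sub>M S) (case_prod g)"
      by (intro MS.integrable_const_bound[of _ B]) auto
    have "(\<integral>x. f x \<partial>distr S simplex_borel stick_series) = (\<integral>\<omega>. f (stick_series \<omega>) \<partial>S)"
      by (rule integral_distr) measurable
    also have "\<dots> = (\<integral>\<omega>. f (stick_series \<omega>)
        \<partial>distr (step_law p \<Otimes>\<^sub>M S) S (\<lambda>(s, \<omega>). case_nat s \<omega>))"
      by (simp only: PiM_iter)
    also have "\<dots> = (\<integral>z. f (stick_series (case z of (s, \<omega>) \<Rightarrow> case_nat s \<omega>)) \<partial>(step_law p \<Otimes>\<^sub>M S))"
      by (rule integral_distr) measurable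
    also have "\<dots> = (\<integral>z. case_prod g z \<partial>(step_law p \<Otimes>\<^sub>M S))"
      by (rule Bochner_Integration.integral_cong) (auto simp: space_pair_measure shift)
    also have "\<dots> = (\<integral>\<omega>. \<integral>s. g s \<omega> \<partial>step_law p \<partial>S)"
      by (rule MS.integral_snd[OF g_int, symmetric])
    also have "\<dots> = (\<integral>\<omega>. df_operator (\<lambda>i x. p i) f (stick_series \<omega>) \<partial>S)"
      using series_in
      by (intro Bochner_Integration.integral_cong)
         (auto simp: g_def df_operator_eq_integral_step_law[OF p f])
    also have "\<dots> = (\<integral>x. df_operator (\<lambda>i x. p i) f x \<partial>distr S simplex_borel stick_series)"
      using borel_measurable_df_operator[OF p f] by (intro integral_distr[symmetric]) measurable
    finally show "(\<integral>x. df_operator (\<lambda>i x. p i) f x \<partial>distr S simplex_borel stick_series)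
        = (\<integral>x. f x \<partial>distr S simplex_borel stick_series)" ..
  qed simp
qed


section \<open>The Hoelder norm and the conclusion\<close>

text \<open>For a Hoelder function the difference quotients are bounded, so their supremum is a Hoelder
  constant; it is nonnegative because the simplex has at least two points, the origin and a
  vertex. The supremum of \<open>norm (f x)\<close> can only enlarge the constant.\<close>

lemma holder_bound_holder_norm:
  fixes f :: "real ^ 'd::finite \<Rightarrow> complex"
  assumes f: "f \<in> holder_space \<alpha>" and "0 < \<alpha>"
  shows "holder_bound \<alpha> (holder_norm \<alpha> f) f" "0 \<le> holder_norm \<alpha> f"
proof -
  obtain C where C: "holder_bound \<alpha> C f"
    using f by (auto simp: holder_space_def holder_bound_def)
  let ?A = "{(x, y). x \<in> simplex_set \<and> y \<in> simplex_set \<and> x \<noteq> y} :: ((real ^ 'd) \<times> (real ^ 'd)) set"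
  let ?q = "\<lambda>(x, y). norm (f x - f y) / norm (x - y) powr \<alpha>"
  have bdd: "bdd_above (?q ` ?A)"
    using holder_boundD[OF C] by (intro bdd_aboveI2[where M = C]) (auto simp: divide_le_eq)
  have quot: "norm (f x - f y) / norm (x - y) powr \<alpha> \<le> holder_seminorm \<alpha> f"
    if "x \<in> simplex_set" "y \<in> simplex_set" "x \<noteq> y" for x y
    unfolding holder_seminorm_def using cSUP_upper[OF _ bdd, of "(x, y)"] that by simp
  have zero: "(0 :: real ^ 'd) \<in> simplex_set" and one: "axis i 1 \<in> simplex_set" for i :: 'd
    using simplex_vertex_in_simplex[of None] simplex_vertex_in_simplex[of "Some i"] by auto
  have semi: "0 \<le> holder_seminorm \<alpha> f"
    using quot[OF zero one] by (rule order_trans[rotated]) (auto simp: axis_eq_0_iff)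
  have "bounded (f ` simplex_set)"
    using holder_bound_imp_bounded_measurable[OF C \<open>0 < \<alpha>\<close>]
    by (simp add: bounded_measurable_on_simplex_def)
  then have "bdd_above ((\<lambda>x. norm (f x)) ` simplex_set)"
    by (simp add: bounded_imp_bdd_above bounded_norm_comp)
  then have sup: "0 \<le> (SUP x\<in>simplex_set. norm (f x))"
    using zero by (intro cSUP_upper2[of _ _ 0]) auto
  show "0 \<le> holder_norm \<alpha> f"
    using semi sup by (simp add: holder_norm_def)
  show "holder_bound \<alpha> (holder_norm \<alpha> f) f"
    unfolding holder_bound_def
  proof (intro ballI)
    fix x y :: "real ^ 'd" assume xy: "x \<in> simplex_set" "y \<in> simplex_set"
    show "norm (f x - f y) \<le> holder_norm \<alpha> f * norm (x - y) powr \<alpha>"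
    proof (cases "x = y")
      case False
      then have "norm (f x - f y) \<le> holder_seminorm \<alpha> f * norm (x - y) powr \<alpha>"
        using quot[OF xy False] by (simp add: divide_le_eq)
      also have "\<dots> \<le> holder_norm \<alpha> f * norm (x - y) powr \<alpha>"
        using sup by (intro mult_right_mono) (auto simp: holder_norm_def)
      finally show ?thesis .
    qed simp
  qed
qed

theorem theorem7:
  fixes p :: "'d::finite option \<Rightarrow> real" and \<alpha> :: real
  assumes "CARD('d) \<ge> 2"
    and "\<And>i. p i \<ge> 0"
    and "(\<Sum>i\<in>UNIV. p i) = 1"
    and "0 < \<alpha>" and "\<alpha> \<le> 1"
  defines "P \<equiv> df_operator (\<lambda>i x. p i)"
  shows "\<exists>\<nu>. invariant_probability P \<nu> \<and>
           (\<forall>\<mu>. invariant_probability P \<mu> \<longrightarrow> \<mu> = \<nu>) \<and>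
           (\<exists>\<kappa>>0. \<exists>\<rho>. 0 < \<rho> \<and> \<rho> < 1 \<and>
              (\<forall>\<phi>\<in>holder_space \<alpha>. \<forall>x\<in>simplex_set. \<forall>n.
                 norm ((P ^^ n) \<phi> x - (\<integral>y. \<phi> y \<partial>\<nu>)) \<le> \<kappa> * \<rho> ^ n * holder_norm \<alpha> \<phi>))"
proof -
  note p = assms(2,3)
  obtain \<nu> where \<nu>: "invariant_probability P \<nu>"
    unfolding P_def using invariant_probability_stick_series[OF p] by blast
  have "norm ((P ^^ n) \<phi> x - (\<integral>y. \<phi> y \<partial>\<nu>)) \<le> 2 powr \<alpha> * (1 / (1 + \<alpha>)) ^ n * holder_norm \<alpha> \<phi>"
    if "\<phi> \<in> holder_space \<alpha>" "x \<in> simplex_set" for \<phi> x n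
    using df_operator_power_converges_to_invariant[OF p \<open>0 < \<alpha>\<close>
        holder_bound_holder_norm[OF that(1) \<open>0 < \<alpha>\<close>] \<nu>[unfolded P_def] that(2), of n]
    by (simp add: P_def mult_ac)
  moreover have "0 < 2 powr \<alpha>" "0 < 1 / (1 + \<alpha>)" "1 / (1 + \<alpha>) < 1"
    using \<open>0 < \<alpha>\<close> by auto
  moreover have "\<mu> = \<nu>" if "invariant_probability P \<mu>" for \<mu>
    using invariant_probability_unique[OF p] that \<nu> by (simp add: P_def)
  ultimately show ?thesis
    using \<nu> by blast
qed

end
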